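(* Let $\mathscr{P}=\{p_\theta:\theta\in\Theta\}$ be a probability model of distributions on $\mathbb{R}^k$, let $\rho$ be a metric (or pseudometric) on $\Theta$, and let the loss function be $\ell(\theta,\hat\theta)=\Phi(\rho(\theta,\hat\theta))$, where $\Phi:\mathbb{R}^+\to\mathbb{R}^+$ is nondecreasing with $\Phi(0)=0$. Let $\delta>0$, let $\{\theta_1,\ldots,\theta_m\}$, $m\ge2$, be any $2\delta$-packing of $\Theta$, and write $p_j=p_{\theta_j}$. Then the minimax risk of estimating $\theta$ from $n$ i.i.d. samples is lower bounded as $$\mathscr{R}_n(\mathscr{P},\ell)\ge\Phi(\delta)\left(1-\frac{(n/m^2)\sum_{j=1}^m\sum_{j'=1}^mD(p_j\|p_{j'})+1}{\log m}\right).$$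
   Context: An estimator is a (measurable) function $\hat\theta:\mathbb{R}^{kn}\to\Theta$. Its risk is $R_n(\theta,\hat\theta)=\mathsf{E}(\ell(\theta,\hat\theta(\mathbf{X}^n)))$ with $\mathbf{X}_1,\ldots,\mathbf{X}_n$ i.i.d. from $p_\theta$, and the minimax risk is $\mathscr{R}_n(\mathscr{P},\ell)=\inf_{\hat\theta}\sup_{\theta\in\Theta}R_n(\theta,\hat\theta)$. Here a $2\delta$-packing of $\Theta$ is a finite set $\{\theta_1,\ldots,\theta_m\}\subseteq\Theta$ with $\rho(\theta_j,\theta_{j'})\ge2\delta$ for every $j\ne j'$. Logarithms are to base 2 and relative entropy $D$ is in bits. $\mathbb{R}^+=[0,\infty)$. *)

theory Defs
  imports "HOL-Probability.Probability"
begin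

(* Not the class metric_space: distinct points may be at distance 0, and only the points of S
   are constrained. *)
definition pseudometric_on :: "'a set \<Rightarrow> ('a \<Rightarrow> 'a \<Rightarrow> real) \<Rightarrow> bool" where
  "pseudometric_on S \<rho> \<longleftrightarrow>
     (\<forall>x\<in>S. \<forall>y\<in>S. 0 \<le> \<rho> x y) \<and>
     (\<forall>x\<in>S. \<rho> x x = 0) \<and>
     (\<forall>x\<in>S. \<forall>y\<in>S. \<rho> x y = \<rho> y x) \<and>
     (\<forall>x\<in>S. \<forall>y\<in>S. \<forall>z\<in>S. \<rho> x z \<le> \<rho> x y + \<rho> y z)"

(* The packing is given by its enumeration; for r > 0 the listed points are necessarily distinct. *)
definition is_packing ::
    "'a set \<Rightarrow> ('a \<Rightarrow> 'a \<Rightarrow> real) \<Rightarrow> real \<Rightarrow> nat \<Rightarrow> (nat \<Rightarrow> 'a) \<Rightarrow> bool" where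
  "is_packing S \<rho> r m t \<longleftrightarrow>
     (\<forall>j\<in>{1..m}. t j \<in> S) \<and>
     (\<forall>j\<in>{1..m}. \<forall>j'\<in>{1..m}. j \<noteq> j' \<longrightarrow> r \<le> \<rho> (t j) (t j'))"

(* Relative entropy D(P || Q) in bits, with values in [0, \<infinity>]. Note the argument order of the
   library: KL_divergence b Q P is the integral of log_b (dP/dQ) with respect to P, and
   absolutely_continuous Q P says P << Q. KL_divergence is real-valued and takes junk values when
   the divergence is infinite. When P << Q are probability measures, the negative part of
   log (dP/dQ) is always P-integrable, so that non-integrability means that the integral is
   \<infinity>. *)
definition relative_entropy :: "'b measure \<Rightarrow> 'b measure \<Rightarrow> ereal" where
  "relative_entropy P Q =
     (if absolutely_continuous Q P \<and> integrable P (entropy_density 2 Q P)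
      then ereal (KL_divergence 2 Q P) else \<infinity>)"

(* n-tuples of observations; for 'b = real ^ 'k this is R^(kn) with its Borel sets. *)
definition sample_space :: "nat \<Rightarrow> (nat \<Rightarrow> 'b::topological_space) measure" where
  "sample_space n = Pi\<^sub>M {1..n} (\<lambda>_. borel)"

(* T is used only as a measurable space; its underlying set is the parameter set. *)
definition estimators ::
    "nat \<Rightarrow> 'a measure \<Rightarrow> ((nat \<Rightarrow> 'b::topological_space) \<Rightarrow> 'a) set" where
  "estimators n T = measurable (sample_space n) T"

(* The law of n i.i.d. samples from p th is the n-fold product measure. The expectation of the
   nonnegative loss is taken in [0, \<infinity>]. *)
definition risk ::
    "nat \<Rightarrow> ('a \<Rightarrow> 'b measure) \<Rightarrow> ('a \<Rightarrow> 'a \<Rightarrow> real)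
      \<Rightarrow> 'a \<Rightarrow> ((nat \<Rightarrow> 'b) \<Rightarrow> 'a) \<Rightarrow> ennreal" where
  "risk n p l \<theta> est = (\<integral>\<^sup>+ x. ennreal (l \<theta> (est x)) \<partial>(Pi\<^sub>M {1..n} (\<lambda>_. p \<theta>)))"

definition minimax_risk ::
    "nat \<Rightarrow> 'a measure \<Rightarrow> ('a \<Rightarrow> 'b::topological_space measure)
      \<Rightarrow> ('a \<Rightarrow> 'a \<Rightarrow> real) \<Rightarrow> ennreal" where
  "minimax_risk n T p l = (INF est\<in>estimators n T. SUP \<theta>\<in>space T. risk n p l \<theta> est)"

end

theory Submission
  imports Defs
begin

text \<open>For $P \ll Q$ and $g > 0$, integrating $\ln y \le \ln 2 - 1 + y / 2$ at $y = g / (dP/dQ)$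
  with respect to $P$ gives
  $\int \ln g\, dP - D(P \| Q) \ln 2 \le \ln 2 - 1 + \frac12 \int g\, dQ$. This is a linearised form
  of the Donsker--Varadhan inequality. The loss being below $\Phi(\delta)$ at $\theta_j$ defines events
  $B_j$, which are disjoint because the $\theta_j$ are $2\delta$-separated. Taking
  $g = 1 + (m - 1) 1_{B_j}$ with $P = p_j^n$, $Q = p_{j'}^n$ and summing over $j, j'$ bounds the average
  of $p_j^n(B_j)$, since $\sum_j p_{j'}^n(B_j) \le 1$. This avoids mutual information, and
  the relative entropy of the products is $n D(p_j \| p_{j'})$.\<close>

section \<open>Densities of finite product measures\<close>

text \<open>A product measure is determined by its values on boxes. On a box the indicator
  factorises over the coordinates, so the integral of the product density splits into
  one-dimensional integrals. This supplies the density of one n-sample law with respect to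
  another.\<close>

lemma PiM_density:
  fixes f :: "'i \<Rightarrow> 'b \<Rightarrow> ennreal"
  assumes "finite I"
    and "product_sigma_finite M"
    and "product_sigma_finite (\<lambda>i. density (M i) (f i))"
    and [measurable]: "\<And>i. f i \<in> borel_measurable (M i)"
  shows "PiM I (\<lambda>i. density (M i) (f i)) = density (PiM I M) (\<lambda>x. \<Prod>i\<in>I. f i (x i))"
proof -
  interpret M: product_sigma_finite M by fact
  interpret D: product_sigma_finite "\<lambda>i. density (M i) (f i)" by fact
  have "density (PiM I M) (\<lambda>x. \<Prod>i\<in>I. f i (x i)) = PiM I (\<lambda>i. density (M i) (f i))"
  proof (rule D.PiM_eqI)
    show "finite I" by fact
    show "sets (density (PiM I M) (\<lambda>x. \<Prod>i\<in>I. f i (x i))) = sets (PiM I (\<lambda>i. density (M i) (f i)))"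
      by (simp cong: sets_PiM_cong)
    fix A assume A: "\<And>i. i \<in> I \<Longrightarrow> A i \<in> sets (density (M i) (f i))"
    have [measurable]: "Pi\<^sub>E I A \<in> sets (PiM I M)"
      using A \<open>finite I\<close> by (intro sets_PiM_I_finite) auto
    have "emeasure (density (PiM I M) (\<lambda>x. \<Prod>i\<in>I. f i (x i))) (Pi\<^sub>E I A) =
        (\<integral>\<^sup>+x. (\<Prod>i\<in>I. f i (x i)) * indicator (Pi\<^sub>E I A) x \<partial>PiM I M)"
      by (rule emeasure_density) auto
    also have "\<dots> = (\<integral>\<^sup>+x. (\<Prod>i\<in>I. f i (x i) * indicator (A i) (x i)) \<partial>PiM I M)"
    proof (rule nn_integral_cong)
      fix x assume "x \<in> space (PiM I M)"
      then have "x \<in> Pi\<^sub>E I A \<longleftrightarrow> (\<forall>i\<in>I. x i \<in> A i)"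
        by (auto simp: space_PiM PiE_iff)
      then have "indicator (Pi\<^sub>E I A) x = (\<Prod>i\<in>I. indicator (A i) (x i) :: ennreal)"
        using \<open>finite I\<close> by (auto simp: indicator_def prod_zero_iff)
      then show "(\<Prod>i\<in>I. f i (x i)) * indicator (Pi\<^sub>E I A) x =
          (\<Prod>i\<in>I. f i (x i) * indicator (A i) (x i))"
        by (simp add: prod.distrib)
    qed
    also have "\<dots> = (\<Prod>i\<in>I. \<integral>\<^sup>+x. f i x * indicator (A i) x \<partial>M i)"
      using A \<open>finite I\<close> by (intro M.product_nn_integral_prod) auto
    also have "\<dots> = (\<Prod>i\<in>I. emeasure (density (M i) (f i)) (A i))"
      using A by (intro prod.cong) (auto simp: emeasure_density)
    finally show "emeasure (density (PiM I M) (\<lambda>x. \<Prod>i\<in>I. f i (x i))) (Pi\<^sub>E I A) =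
        (\<Prod>i\<in>I. emeasure (density (M i) (f i)) (A i))" .
  qed
  then show ?thesis ..
qed

section \<open>Change of measure for a single event\<close>

text \<open>This is the tangent of the concave function \<open>ln\<close> at 2. A tangent at s would
  leave the constant ln s - 1 + 2/s (up to a term of order 1/m) after averaging over all pairs in
  \<open>fano_PiM\<close>. The choice s = 2 minimises it, and the minimum ln 2 is exactly one
  bit.\<close>

lemma ln_le_tangent_at_2:
  fixes y :: real
  assumes "0 < y"
  shows "ln y \<le> ln 2 - 1 + y / 2"
  using ln_le_minus_one[of "y / 2"] assms by (simp add: ln_div)

text \<open>The tangent bound is integrated against \<open>P\<close> at y = g / Z, where g equals
  \<open>c\<close> on \<open>B\<close> and 1 elsewhere. Then ln g is ln c times the indicator of
  \<open>B\<close>, which produces the left-hand side, and the integral of g / Z under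
  \<open>P\<close> is controlled by that of g under \<open>Q\<close>.\<close>

lemma event_prob_le_log_density:
  fixes Z :: "'b \<Rightarrow> real"
  assumes "prob_space Q" and "prob_space P"
    and P: "P = density Q (\<lambda>x. ennreal (Z x))"
    and [measurable]: "Z \<in> borel_measurable Q"
    and int: "integrable P (\<lambda>x. ln (Z x))"
    and [measurable]: "B \<in> sets Q"
    and c: "1 \<le> c"
  shows "ln c * measure P B \<le>
    (\<integral>x. ln (Z x) \<partial>P) + ln 2 - 1 + (1 + (c - 1) * measure Q B) / 2"
proof -
  interpret Q: prob_space Q by fact
  interpret P: prob_space P by fact
  define g :: "'b \<Rightarrow> real" where "g x = 1 + (c - 1) * indicator B x" for x
  have g_meas [measurable]: "g \<in> borel_measurable Q"
    unfolding g_def by measurable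
  have sets_P [measurable_cong]: "sets P = sets Q"
    by (simp add: P)
  have BP: "B \<in> sets P"
    by (simp add: sets_P)
  have g_pos: "0 < g x" for x
    using c by (auto simp: g_def indicator_def)
  have ln_g: "ln (g x) = ln c * indicator B x" for x
    by (auto simp: g_def indicator_def)
  \<comment> \<open>The conversion to \<open>ennreal\<close> turns negative values of
    \<open>Z\<close> into 0, so \<open>P\<close> gives no mass to the set where \<open>Z\<close> is
    not positive.\<close>
  have Z_pos: "AE x in P. 0 < Z x"
    unfolding P by (subst AE_density) auto
  have [simp]: "integrable Q (indicator B :: 'b \<Rightarrow> real)"
    by (simp add: less_top[symmetric])
  have int_g: "integrable Q g"
    unfolding g_def by (intro Bochner_Integration.integrable_add) auto
  have lint_g: "(\<integral>x. g x \<partial>Q) = 1 + (c - 1) * measure Q B"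
    unfolding g_def by (subst Bochner_Integration.integral_add) (auto simp: Q.prob_space less_top[symmetric])
  have "(\<integral>\<^sup>+x. ennreal (g x / Z x) \<partial>P) = (\<integral>\<^sup>+x. ennreal (Z x) * ennreal (g x / Z x) \<partial>Q)"
    unfolding P by (rule nn_integral_density) auto
  \<comment> \<open>Equality can fail: where \<open>Z\<close> is not positive the left integrand is
    0 while g is still positive, and \<open>Q\<close> may charge that set.\<close>
  also have "\<dots> \<le> (\<integral>\<^sup>+x. ennreal (g x) \<partial>Q)"
  proof (rule nn_integral_mono)
    fix x
    show "ennreal (Z x) * ennreal (g x / Z x) \<le> ennreal (g x)"
    proof (cases "0 < Z x")
      case True
      then show ?thesis
        using g_pos[of x] by (simp add: ennreal_mult[symmetric])
    qed (simp add: ennreal_neg)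
  qed
  also have "\<dots> = ennreal (1 + (c - 1) * measure Q B)"
    using nn_integral_eq_integral[OF int_g] g_pos less_imp_le lint_g by auto
  finally have nn: "(\<integral>\<^sup>+x. ennreal (g x / Z x) \<partial>P) \<le> ennreal (1 + (c - 1) * measure Q B)" .
  have nonneg: "AE x in P. 0 \<le> g x / Z x"
    using Z_pos by eventually_elim (auto simp: g_pos less_imp_le)
  have int_h: "integrable P (\<lambda>x. g x / Z x)"
    using nn nonneg by (intro integrableI_nonneg) (auto intro: le_less_trans)
  have lint_h: "(\<integral>x. g x / Z x \<partial>P) \<le> 1 + (c - 1) * measure Q B"
  proof -
    have "ennreal (\<integral>x. g x / Z x \<partial>P) \<le> ennreal (1 + (c - 1) * measure Q B)"
      using nn nn_integral_eq_integral[OF int_h nonneg] by simp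
    then show ?thesis
      using c by (subst (asm) ennreal_le_iff) auto
  qed
  have int_lhs: "integrable P (\<lambda>x. ln c * indicator B x - ln (Z x))"
    using int BP by (intro Bochner_Integration.integrable_diff) (auto simp: less_top[symmetric])
  have "ln c * measure P B - (\<integral>x. ln (Z x) \<partial>P) = (\<integral>x. ln c * indicator B x - ln (Z x) \<partial>P)"
    using int BP by (subst Bochner_Integration.integral_diff) (auto simp: less_top[symmetric])
  also have "\<dots> \<le> (\<integral>x. (ln 2 - 1) + (g x / Z x) / 2 \<partial>P)"
  proof (rule integral_mono_AE[OF int_lhs])
    show "integrable P (\<lambda>x. (ln 2 - 1) + (g x / Z x) / 2)"
      using int_h by (intro Bochner_Integration.integrable_add integrable_divide) auto
    show "AE x in P. ln c * indicator B x - ln (Z x) \<le> (ln 2 - 1) + (g x / Z x) / 2"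
      using Z_pos
    proof eventually_elim
      case (elim x)
      then have "ln (g x / Z x) \<le> ln 2 - 1 + (g x / Z x) / 2"
        using g_pos by (intro ln_le_tangent_at_2) auto
      then show ?case
        using elim g_pos[of x] by (simp add: ln_div ln_g[symmetric])
    qed
  qed
  also have "\<dots> = (ln 2 - 1) + (\<integral>x. g x / Z x \<partial>P) / 2"
    using int_h by (subst Bochner_Integration.integral_add) (auto simp: P.prob_space simp del: divide_divide_eq_left)
  finally show ?thesis
    using divide_right_mono[OF lint_h, of 2] by linarith
qed

text \<open>Tensorisation: the logarithm of the product density is a sum over coordinates, each of
  which has law \<open>P\<close> under the product, so its expectation is \<open>card I\<close>
  times that of a single observation.\<close>

lemma event_prob_PiM_le_log_density:
  fixes r :: "'b \<Rightarrow> real"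
  assumes "finite I" and "prob_space Q" and "prob_space P"
    and P: "P = density Q (\<lambda>x. ennreal (r x))"
    and [measurable]: "r \<in> borel_measurable Q"
    and int: "integrable P (\<lambda>x. ln (r x))"
    and B: "B \<in> sets (PiM I (\<lambda>_. Q))"
    and c: "1 \<le> c"
  shows "ln c * measure (PiM I (\<lambda>_. P)) B \<le>
    real (card I) * (\<integral>x. ln (r x) \<partial>P) + ln 2 - 1
      + (1 + (c - 1) * measure (PiM I (\<lambda>_. Q)) B) / 2"
proof -
  interpret P: prob_space P by fact
  interpret Q: prob_space Q by fact
  interpret PP: product_prob_space "\<lambda>_. P" by unfold_locales
  interpret QQ: product_prob_space "\<lambda>_. Q" by unfold_locales
  let ?P = "PiM I (\<lambda>_. P)" and ?Q = "PiM I (\<lambda>_. Q)"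
  \<comment> \<open>Clipping at 0 matters because \<open>r\<close> may take negative values: two
    negative factors would have a positive real product, whereas the product of their
    \<open>ennreal\<close> images is 0.\<close>
  let ?Z = "\<lambda>x. \<Prod>i\<in>I. max 0 (r (x i))"
  have ennreal_max: "ennreal (max 0 (r x)) = ennreal (r x)" for x
    by (simp add: max_def ennreal_neg)
  have dens: "?P = density ?Q (\<lambda>x. ennreal (?Z x))"
  proof -
    have "PiM I (\<lambda>_. density Q (\<lambda>x. ennreal (r x))) =
        density ?Q (\<lambda>x. \<Prod>i\<in>I. ennreal (r (x i)))"
      using \<open>finite I\<close> PP.product_sigma_finite_axioms QQ.product_sigma_finite_axioms
      by (intro PiM_density) (auto simp: P)
    then show ?thesis
      by (simp add: P prod_ennreal[symmetric] ennreal_max)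
  qed
  have r_pos: "AE x in P. 0 < r x"
    unfolding P by (subst AE_density) auto
  have distr: "distr ?P P (\<lambda>x. x i) = P" if "i \<in> I" for i
    using distr_PiM_component[of I "\<lambda>_. P" i] that \<open>prob_space P\<close> by simp
  have comp [measurable]: "(\<lambda>x. x i) \<in> measurable ?P P" if "i \<in> I" for i
    using that by measurable
  have int_comp: "integrable ?P (\<lambda>x. ln (r (x i)))" if "i \<in> I" for i
    using integrable_distr[OF comp[OF that], of "\<lambda>x. ln (r x)"] int distr[OF that] by simp
  have lint_comp: "(\<integral>x. ln (r (x i)) \<partial>?P) = (\<integral>x. ln (r x) \<partial>P)" if "i \<in> I" for i
    using integral_distr[OF comp[OF that], of "\<lambda>x. ln (r x)"] int distr[OF that]
    by (simp add: borel_measurable_integrable)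
  have "AE x in ?P. \<forall>i\<in>I. 0 < r (x i)"
    using \<open>finite I\<close> \<open>prob_space P\<close> r_pos by (intro AE_finite_allI AE_PiM_component) auto
  then have ln_Z: "AE x in ?P. ln (?Z x) = (\<Sum>i\<in>I. ln (r (x i)))"
  proof eventually_elim
    case (elim x)
    then have "?Z x = (\<Prod>i\<in>I. r (x i))"
      by (intro prod.cong) auto
    then show ?case
      using elim \<open>finite I\<close> by (subst ln_prod) auto
  qed
  have Z_meas [measurable]: "?Z \<in> borel_measurable ?Q"
    by measurable
  have sets_PQ [measurable_cong]: "sets ?P = sets ?Q"
    by (simp add: dens)
  have lnZ_meas: "(\<lambda>x. ln (?Z x)) \<in> borel_measurable ?P"
    by measurable
  have sum_meas: "(\<lambda>x. \<Sum>i\<in>I. ln (r (x i))) \<in> borel_measurable ?P"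
    using int_comp by (intro borel_measurable_sum) auto
  have int_Z: "integrable ?P (\<lambda>x. ln (?Z x))"
    using integrable_cong_AE[OF lnZ_meas sum_meas ln_Z] int_comp by simp
  have "(\<integral>x. ln (?Z x) \<partial>?P) = (\<integral>x. (\<Sum>i\<in>I. ln (r (x i))) \<partial>?P)"
    by (rule integral_cong_AE[OF lnZ_meas sum_meas ln_Z])
  also have "\<dots> = real (card I) * (\<integral>x. ln (r x) \<partial>P)"
    using int_comp lint_comp by (simp add: Bochner_Integration.integral_sum)
  finally have lint: "(\<integral>x. ln (?Z x) \<partial>?P) = real (card I) * (\<integral>x. ln (r x) \<partial>P)" .
  show ?thesis
    using event_prob_le_log_density[OF _ _ dens Z_meas int_Z B c] lint
      PP.prob_space_axioms QQ.prob_space_axioms by (simp add: prob_space_PiM \<open>prob_space P\<close> \<open>prob_space Q\<close>)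
qed

text \<open>The guard \<open>I \<noteq> {}\<close> on \<open>d\<close> is there because \<open>0 * \<infinity> = 0\<close> in \<open>ereal\<close>: with no
  observations the bound has to hold even when the divergence is infinite.\<close>

lemma event_prob_PiM_le_relative_entropy:
  assumes "finite I" and Q: "prob_space Q" and P: "prob_space P"
    and sets: "sets P = sets Q"
    and d: "I \<noteq> {} \<Longrightarrow> relative_entropy P Q = ereal d"
    and B: "B \<in> sets (PiM I (\<lambda>_. Q))"
    and c: "1 \<le> c"
  shows "ln c * measure (PiM I (\<lambda>_. P)) B \<le>
    real (card I) * (d * ln 2) + ln 2 - 1
      + (1 + (c - 1) * measure (PiM I (\<lambda>_. Q)) B) / 2"
proof (cases "I = {}")
  case True
  \<comment> \<open>With no coordinates both products are the same one-point measure, so the density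
    is 1 and its logarithm contributes nothing.\<close>
  have eq: "PiM I (\<lambda>_. P) = PiM I (\<lambda>_. Q)"
    by (simp add: True PiM_empty)
  have "ln c * measure (PiM I (\<lambda>_. Q)) B \<le>
      (\<integral>x. ln 1 \<partial>PiM I (\<lambda>_. Q)) + ln 2 - 1 + (1 + (c - 1) * measure (PiM I (\<lambda>_. Q)) B) / 2"
    using Q B c
    by (intro event_prob_le_log_density) (auto intro!: prob_space_PiM simp: density_1)
  then show ?thesis
    unfolding eq by (simp add: True)
next
  case False
  interpret Q: prob_space Q by fact
  interpret P: prob_space P by fact
  let ?r = "\<lambda>x. enn2real (RN_deriv Q P x)"
  from d[OF False] have ac: "absolutely_continuous Q P"
    and int: "integrable P (entropy_density 2 Q P)"
    and d': "d = KL_divergence 2 Q P"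
    by (auto simp: relative_entropy_def split: if_splits)
  \<comment> \<open>Finiteness almost everywhere allows the derivative to be replaced by its
    real-valued version, since \<open>enn2real\<close> sends \<infinity> to 0.\<close>
  have "AE x in Q. RN_deriv Q P x \<noteq> \<infinity>"
    using ac sets by (intro Q.RN_deriv_finite) (auto intro: P.sigma_finite_measure_axioms)
  then have "density Q (RN_deriv Q P) = density Q (\<lambda>x. ennreal (?r x))"
    by (intro density_cong) (auto simp: less_top elim!: eventually_mono)
  then have dens: "P = density Q (\<lambda>x. ennreal (?r x))"
    using Q.density_RN_deriv[OF ac sets] by simp
  \<comment> \<open>The factor \<open>ln 2\<close> converts bits into nats.\<close>
  have ln_r: "(\<lambda>x. ln (?r x)) = (\<lambda>x. entropy_density 2 Q P x * ln 2)"
    by (simp add: entropy_density_def log_def fun_eq_iff)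
  have "integrable P (\<lambda>x. ln (?r x))"
    unfolding ln_r using int by simp
  from event_prob_PiM_le_log_density[OF \<open>finite I\<close> Q P dens _ this B c]
  show ?thesis
    unfolding ln_r by (simp add: d' KL_divergence_def)
qed

section \<open>A Fano-type inequality for disjoint events\<close>

text \<open>\<open>B j\<close> plays the role of the event that a test decides for j. The bound for
  one event is applied with \<open>c = real m\<close> to all ordered pairs, the diagonal included,
  and then averaged; disjointness keeps the total of the \<open>Q\<close>-terms small.\<close>

lemma fano_PiM:
  fixes P :: "nat \<Rightarrow> 'b measure"
  assumes "finite I"
    and prob: "\<And>j. j \<in> {1..m} \<Longrightarrow> prob_space (P j)"
    and sets: "\<And>j. j \<in> {1..m} \<Longrightarrow> sets (P j) = sets S"
    and d: "\<And>j j'. I \<noteq> {} \<Longrightarrow> j \<in> {1..m} \<Longrightarrow> j' \<in> {1..m} \<Longrightarrow>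
      relative_entropy (P j) (P j') = ereal (d j j')"
    and B: "\<And>j. j \<in> {1..m} \<Longrightarrow> B j \<in> sets (PiM I (\<lambda>_. S))"
    and disj: "disjoint_family_on B {1..m}"
    and m: "2 \<le> m"
  shows "(\<Sum>j=1..m. measure (PiM I (\<lambda>_. P j)) (B j)) / real m \<le>
    (real (card I) / (real m)\<^sup>2 * (\<Sum>j=1..m. \<Sum>j'=1..m. d j j') + 1) / log 2 (real m)"
proof -
  let ?a = "\<lambda>j. measure (PiM I (\<lambda>_. P j)) (B j)"
  let ?b = "\<lambda>j j'. measure (PiM I (\<lambda>_. P j')) (B j)"
  let ?n = "real (card I)"
  let ?D = "\<Sum>j=1..m. \<Sum>j'=1..m. d j j'"
  have setsP: "sets (PiM I (\<lambda>_. P j)) = sets (PiM I (\<lambda>_. S))" if "j \<in> {1..m}" for j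
    using sets[OF that] by (intro sets_PiM_cong) auto
  have pair: "ln (real m) * ?a j \<le> ?n * (d j j' * ln 2) + ln 2 - 1 + (1 + (real m - 1) * ?b j j') / 2"
    if "j \<in> {1..m}" "j' \<in> {1..m}" for j j'
    using that m by (intro event_prob_PiM_le_relative_entropy) (auto simp: assms setsP)
  have b_sum: "(\<Sum>j=1..m. ?b j j') \<le> 1" if j': "j' \<in> {1..m}" for j'
  proof -
    interpret prob_space "PiM I (\<lambda>_. P j')"
      using prob[OF j'] by (intro prob_space_PiM)
    have "(\<Sum>j=1..m. ?b j j') = prob (\<Union>j\<in>{1..m}. B j)"
      using B setsP[OF j'] disj by (intro finite_measure_finite_Union[symmetric]) auto
    then show ?thesis by simp
  qed
  have "real m * (ln (real m) * (\<Sum>j=1..m. ?a j)) = (\<Sum>j=1..m. \<Sum>j'=1..m. ln (real m) * ?a j)"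
    by (simp add: sum_distrib_left mult_ac)
  also have "\<dots> \<le> (\<Sum>j=1..m. \<Sum>j'=1..m.
      ?n * (d j j' * ln 2) + ln 2 - 1 + (1 + (real m - 1) * ?b j j') / 2)"
    using pair by (intro sum_mono) auto
  also have "\<dots> = ?n * ln 2 * ?D + (real m)\<^sup>2 * (ln 2 - 1 / 2)
      + (real m - 1) / 2 * (\<Sum>j=1..m. \<Sum>j'=1..m. ?b j j')"
  proof -
    have "?n * (d j j' * ln 2) + ln 2 - 1 + (1 + (real m - 1) * ?b j j') / 2 =
        ?n * ln 2 * d j j' + (ln 2 - 1 / 2) + (real m - 1) / 2 * ?b j j'" for j j'
      by (simp add: field_simps)
    then show ?thesis
      by (simp only: sum.distrib sum_distrib_left[symmetric])
        (simp add: power2_eq_square)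
  qed
  \<comment> \<open>After swapping the sums, the inner one runs over disjoint events under one fixed
    measure, so it is at most 1.\<close>
  also have "(\<Sum>j=1..m. \<Sum>j'=1..m. ?b j j') \<le> real m"
  proof (subst sum.swap)
    have "(\<Sum>j'=1..m. \<Sum>j=1..m. ?b j j') \<le> (\<Sum>j'=1..m. 1)"
      using b_sum by (intro sum_mono) auto
    then show "(\<Sum>j'=1..m. \<Sum>j=1..m. ?b j j') \<le> real m" by simp
  qed
  then have "?n * ln 2 * ?D + (real m)\<^sup>2 * (ln 2 - 1 / 2)
      + (real m - 1) / 2 * (\<Sum>j=1..m. \<Sum>j'=1..m. ?b j j')
      \<le> ?n * ln 2 * ?D + (real m)\<^sup>2 * (ln 2 - 1 / 2) + (real m - 1) / 2 * real m"
    using m by (intro add_left_mono mult_left_mono) auto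
  \<comment> \<open>The terms without \<open>?D\<close> add up to
    \<open>(real m)\<^sup>2 * ln 2 - real m / 2\<close>, and the negative remainder is
    dropped.\<close>
  also have "\<dots> \<le> ln 2 * (?n * ?D + (real m)\<^sup>2)"
    by (simp add: power2_eq_square field_simps)
  finally have "real m * (ln (real m) * (\<Sum>j=1..m. ?a j)) \<le> ln 2 * (?n * ?D + (real m)\<^sup>2)" .
  then have "real m * (log 2 (real m) * (\<Sum>j=1..m. ?a j)) \<le> ?n * ?D + (real m)\<^sup>2"
    by (simp add: log_def field_simps)
  then show ?thesis
    using m by (simp add: field_simps power2_eq_square)
qed

section \<open>Reduction from estimation to testing\<close>

text \<open>Markov's inequality, phrased through the low-loss event and without dividing by
  \<open>c\<close>, so that \<open>c = 0\<close> is covered.\<close>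

lemma markov_risk_bound:
  fixes f :: "'b \<Rightarrow> real"
  assumes "prob_space M" and [measurable]: "f \<in> borel_measurable M" and "0 \<le> c"
  shows "ennreal (c * (1 - measure M {x \<in> space M. f x < c})) \<le> (\<integral>\<^sup>+x. ennreal (f x) \<partial>M)"
proof -
  interpret prob_space M by fact
  have "ennreal (c * (1 - measure M {x \<in> space M. f x < c})) =
      ennreal c * emeasure M (space M - {x \<in> space M. f x < c})"
    using \<open>0 \<le> c\<close> by (simp add: ennreal_mult emeasure_eq_measure prob_compl)
  also have "\<dots> = (\<integral>\<^sup>+x. ennreal c * indicator (space M - {x \<in> space M. f x < c}) x \<partial>M)"
    by (simp add: nn_integral_cmult_indicator)
  also have "\<dots> \<le> (\<integral>\<^sup>+x. ennreal (f x) \<partial>M)"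
    by (intro nn_integral_mono) (auto simp: indicator_def intro!: ennreal_leI)
  finally show ?thesis .
qed

lemma exists_le_average:
  fixes a :: "nat \<Rightarrow> real"
  assumes "(\<Sum>j=1..m. a j) / real m \<le> A" and "0 < m"
  shows "\<exists>j\<in>{1..m}. a j \<le> A"
proof (rule ccontr)
  assume "\<not> (\<exists>j\<in>{1..m}. a j \<le> A)"
  then have "(\<Sum>j=1..m. A) < (\<Sum>j=1..m. a j)"
    using \<open>0 < m\<close> by (intro sum_strict_mono) (auto simp: not_le)
  with assms show False
    by (simp add: field_simps)
qed

text \<open>By monotonicity, a loss below \<open>\<Phi> \<delta>\<close> forces a distance below
  \<delta>. Two such packing points would then be less than 2 \<delta> apart by the triangle
  inequality.\<close>

lemma packing_low_loss_unique:
  fixes \<Phi> :: "real \<Rightarrow> real"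
  assumes "pseudometric_on S \<rho>" and "mono_on {0..} \<Phi>"
    and "is_packing S \<rho> (2 * \<delta>) m t" and "0 \<le> \<delta>"
    and "j \<in> {1..m}" "j' \<in> {1..m}" and "y \<in> S"
    and "\<Phi> (\<rho> (t j) y) < \<Phi> \<delta>" "\<Phi> (\<rho> (t j') y) < \<Phi> \<delta>"
  shows "j = j'"
proof (rule ccontr)
  assume "j \<noteq> j'"
  have tS: "t j \<in> S" "t j' \<in> S"
    using assms by (auto simp: is_packing_def)
  have *: "\<rho> u y < \<delta>" if "u \<in> S" "\<Phi> (\<rho> u y) < \<Phi> \<delta>" for u
  proof (rule ccontr)
    assume "\<not> \<rho> u y < \<delta>"
    then have "\<Phi> \<delta> \<le> \<Phi> (\<rho> u y)"
      using \<open>0 \<le> \<delta>\<close> by (intro mono_onD[OF assms(2)]) auto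
    with that show False by simp
  qed
  have "2 * \<delta> \<le> \<rho> (t j) (t j')"
    using assms \<open>j \<noteq> j'\<close> by (auto simp: is_packing_def)
  also have "\<dots> \<le> \<rho> (t j) y + \<rho> y (t j')"
    using assms(1,7) tS unfolding pseudometric_on_def by blast
  also have "\<rho> y (t j') = \<rho> (t j') y"
    using assms(1,7) tS unfolding pseudometric_on_def by blast
  also have "\<rho> (t j) y + \<rho> (t j') y < 2 * \<delta>"
    using *[OF tS(1)] *[OF tS(2)] assms by simp
  finally show False by simp
qed

theorem theorem0p13:
  fixes \<Theta> :: "'a set"
    and T :: "'a measure"
    and p :: "'a \<Rightarrow> (real ^ 'k) measure"
    and \<rho> :: "'a \<Rightarrow> 'a \<Rightarrow> real"
    and \<Phi> :: "real \<Rightarrow> real"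
    and l :: "'a \<Rightarrow> 'a \<Rightarrow> real"
    and \<delta> :: real
    and m n :: nat
    and t :: "nat \<Rightarrow> 'a"
  assumes model: "\<And>\<theta>. \<theta> \<in> \<Theta> \<Longrightarrow> prob_space (p \<theta>) \<and> sets (p \<theta>) = sets borel"
    and pseudometric: "pseudometric_on \<Theta> \<rho>"
    and Phi_nonneg: "\<And>x. 0 \<le> x \<Longrightarrow> 0 \<le> \<Phi> x"
    and Phi_mono: "mono_on {0..} \<Phi>"
    and Phi_zero: "\<Phi> 0 = 0"
    and loss: "l = (\<lambda>\<theta> \<theta>'. \<Phi> (\<rho> \<theta> \<theta>'))"
    and param_space: "space T = \<Theta>"
    and loss_measurable: "\<And>\<theta>. \<theta> \<in> \<Theta> \<Longrightarrow> l \<theta> \<in> borel_measurable T"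
    and delta_pos: "0 < \<delta>"
    and m_ge_2: "2 \<le> m"
    and packing: "is_packing \<Theta> \<rho> (2 * \<delta>) m t"
  shows "enn2ereal (minimax_risk n T p l) \<ge>
    ereal (\<Phi> \<delta>) *
      (1 - (ereal (real n / (real m)\<^sup>2) *
              (\<Sum>j=1..m. \<Sum>j'=1..m. relative_entropy (p (t j)) (p (t j'))) + 1)
            / ereal (log 2 (real m)))"
proof -
  let ?D = "\<Sum>j=1..m. \<Sum>j'=1..m. relative_entropy (p (t j)) (p (t j'))"
  have tS: "t j \<in> \<Theta>" if "j \<in> {1..m}" for j
    using packing that by (auto simp: is_packing_def)
  have re_MInf: "relative_entropy P Q \<noteq> -\<infinity>" for P Q :: "(real ^ 'k) measure"
    by (simp add: relative_entropy_def)
  have Phi_pos: "0 \<le> \<Phi> \<delta>"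
    using Phi_nonneg delta_pos by simp
  have log_pos: "0 < log 2 (real m)"
    using m_ge_2 by simp
  show ?thesis
  \<comment> \<open>An infinite divergence with at least one sample makes the bracket equal to
    -\<infinity>, so the right-hand side is at most 0. For n = 0 the convention 0 * \<infinity> = 0
    keeps the right-hand side finite, so that case belongs to the other branch.\<close>
  proof (cases "n \<noteq> 0 \<and> (\<exists>j\<in>{1..m}. \<exists>j'\<in>{1..m}. relative_entropy (p (t j)) (p (t j')) = \<infinity>)")
    case True
    then have "?D = \<infinity>"
      using re_MInf by (auto simp: sum_Pinfty)
    then have "ereal (real n / (real m)\<^sup>2) * ?D = \<infinity>"
      using True m_ge_2 by simp
    moreover have "1 - (\<infinity> + 1) / ereal (log 2 (real m)) = -\<infinity>"
      using log_pos by (simp add: one_ereal_def)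
    ultimately have "1 - (ereal (real n / (real m)\<^sup>2) * ?D + 1) / ereal (log 2 (real m)) = -\<infinity>"
      by (simp only:)
    \<comment> \<open>If \<open>\<Phi> \<delta> = 0\<close>, the product is 0 and not
      -\<infinity>.\<close>
    moreover have "ereal (\<Phi> \<delta>) * -\<infinity> \<le> 0"
      using Phi_pos by (cases "\<Phi> \<delta> = 0") (simp_all add: zero_ereal_def[symmetric])
    ultimately have "ereal (\<Phi> \<delta>) *
        (1 - (ereal (real n / (real m)\<^sup>2) * ?D + 1) / ereal (log 2 (real m))) \<le> 0"
      by (simp only:)
    then show ?thesis
      using order_trans enn2ereal_nonneg by blast
  next
    case False
    \<comment> \<open>For n = 0 some divergences may be infinite, and \<open>real_of_ereal\<close>
      then returns 0; the prefactor is 0 as well, so \<open>A\<close> is unaffected.\<close>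
    define d where "d j j' = real_of_ereal (relative_entropy (p (t j)) (p (t j')))" for j j'
    have d: "relative_entropy (p (t j)) (p (t j')) = ereal (d j j')"
      if "n \<noteq> 0" "j \<in> {1..m}" "j' \<in> {1..m}" for j j'
      using False that re_MInf unfolding d_def by (auto simp: ereal_real)
    define A where "A = (real n / (real m)\<^sup>2 * (\<Sum>j=1..m. \<Sum>j'=1..m. d j j') + 1) / log 2 (real m)"
    have "ereal (real n / (real m)\<^sup>2) * ?D =
        ereal (real n / (real m)\<^sup>2 * (\<Sum>j=1..m. \<Sum>j'=1..m. d j j'))"
    proof (cases "n = 0")
      case False
      then have "?D = (\<Sum>j=1..m. \<Sum>j'=1..m. ereal (d j j'))"
        using d by (intro sum.cong) auto
      then show ?thesis by simp
    qed (simp add: zero_ereal_def[symmetric])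
    then have rhs: "ereal (\<Phi> \<delta>) *
        (1 - (ereal (real n / (real m)\<^sup>2) * ?D + 1) / ereal (log 2 (real m))) = ereal (\<Phi> \<delta> * (1 - A))"
      using log_pos by (simp add: A_def one_ereal_def)
    have "ennreal (\<Phi> \<delta> * (1 - A)) \<le> (SUP \<theta>\<in>\<Theta>. risk n p l \<theta> est)"
      if est: "est \<in> estimators n T" for est
    proof -
      define S :: "(real ^ 'k) measure" where "S = borel"
      have est_meas [measurable]: "est \<in> measurable (PiM {1..n} (\<lambda>_. S)) T"
        using est by (simp add: estimators_def sample_space_def S_def)
      \<comment> \<open>The strict inequality serves both ends: it forces a distance below \<delta>,
        hence disjointness, and off \<open>B j\<close> the loss is at least
        \<open>\<Phi> \<delta>\<close>.\<close>
      define B where "B j = {x \<in> space (PiM {1..n} (\<lambda>_. S)). l (t j) (est x) < \<Phi> \<delta>}" for j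
      have setsP: "sets (PiM {1..n} (\<lambda>_. p (t j))) = sets (PiM {1..n} (\<lambda>_. S))"
        if "j \<in> {1..m}" for j
        using model[OF tS[OF that]] by (intro sets_PiM_cong) (auto simp: S_def)
      have loss_est [measurable]: "(\<lambda>x. l (t j) (est x)) \<in> borel_measurable (PiM {1..n} (\<lambda>_. S))"
        if "j \<in> {1..m}" for j
        using measurable_compose[OF est_meas loss_measurable[OF tS[OF that]]] .
      have "disjoint_family_on B {1..m}"
        unfolding disjoint_family_on_def
      proof (intro ballI impI)
        fix j j' assume jj: "j \<in> {1..m}" "j' \<in> {1..m}" "j \<noteq> j'"
        have "j = j'" if "x \<in> B j" "x \<in> B j'" for x
          using that jj measurable_space[OF est_meas, of x] delta_pos
          by (intro packing_low_loss_unique[OF pseudometric Phi_mono packing, of j j' "est x"])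
            (auto simp: B_def loss param_space)
        with jj show "B j \<inter> B j' = {}" by auto
      qed
      then have "(\<Sum>j=1..m. measure (PiM {1..n} (\<lambda>_. p (t j))) (B j)) / real m \<le> A"
        using fano_PiM[of "{1..n}" m "\<lambda>j. p (t j)" S d B] model tS d m_ge_2 loss_est
        by (simp add: A_def S_def B_def)
      \<comment> \<open>The index depends on \<open>est\<close>, which is harmless because the
        supremum over \<theta> is taken for each estimator separately.\<close>
      then obtain j where j: "j \<in> {1..m}" "measure (PiM {1..n} (\<lambda>_. p (t j))) (B j) \<le> A"
        using exists_le_average[of "\<lambda>j. measure (PiM {1..n} (\<lambda>_. p (t j))) (B j)" m A] m_ge_2
        by (metis less_le_trans zero_less_numeral)
      have "ennreal (\<Phi> \<delta> * (1 - A)) \<le> ennreal (\<Phi> \<delta> * (1 - measure (PiM {1..n} (\<lambda>_. p (t j))) (B j)))"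
        using j Phi_pos by (intro ennreal_leI mult_left_mono) auto
      also have "\<dots> \<le> risk n p l (t j) est"
      proof -
        have "B j = {x \<in> space (PiM {1..n} (\<lambda>_. p (t j))). l (t j) (est x) < \<Phi> \<delta>}"
          using sets_eq_imp_space_eq[OF setsP[OF j(1)]] by (simp add: B_def)
        moreover have "(\<lambda>x. l (t j) (est x)) \<in> borel_measurable (PiM {1..n} (\<lambda>_. p (t j)))"
          using loss_est[OF j(1)] measurable_cong_sets[OF setsP[OF j(1)] refl] by blast
        moreover have "prob_space (PiM {1..n} (\<lambda>_. p (t j)))"
          using model[OF tS[OF j(1)]] by (intro prob_space_PiM) auto
        ultimately show ?thesis
          using Phi_pos by (simp add: risk_def markov_risk_bound)
      qed
      also have "\<dots> \<le> (SUP \<theta>\<in>\<Theta>. risk n p l \<theta> est)"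
        using tS j(1) by (intro SUP_upper) auto
      finally show ?thesis .
    qed
    then have "ennreal (\<Phi> \<delta> * (1 - A)) \<le> minimax_risk n T p l"
      unfolding minimax_risk_def param_space by (intro INF_greatest) auto
    then have "enn2ereal (ennreal (\<Phi> \<delta> * (1 - A))) \<le> enn2ereal (minimax_risk n T p l)"
      by (simp add: less_eq_ennreal.rep_eq)
    \<comment> \<open>Only an inequality holds: for \<open>A > 1\<close> the real value is
      nonpositive and \<open>ennreal\<close> truncates it to 0.\<close>
    moreover have "ereal (\<Phi> \<delta> * (1 - A)) \<le> enn2ereal (ennreal (\<Phi> \<delta> * (1 - A)))"
      by (simp add: ennreal.rep_eq)
    ultimately show ?thesis
      unfolding rhs by (rule order_trans[rotated])
  qed
qed

end
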